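(* Let $N\geq1$, $p\geq1$, and let $f:\mathbb{R}^N\times\mathbb{M}^{N\times N}\to[0,+\infty]$ be a normal integrand satisfying: there exist $\alpha,\beta>0$ such that for every $(x,\xi)\in\mathbb{R}^N\times\mathbb{M}^{N\times N}$, if $|\det\xi|\geq\alpha$ then $f(x,\xi)\leq\beta(1+|\xi|^p)$. Then $\mathcal{Z} f$ is of $p$-polynomial growth, i.e. there is $c>0$ with $\mathcal{Z} f(x,\xi)\leq c(1+|\xi|^p)$ for all $(x,\xi)\in\mathbb{R}^N\times\mathbb{M}^{N\times N}$.
   Context: $\mathbb{M}^{N\times N}$: real $N\times N$ matrices. A normal integrand is a measurable $f$ with $f(x,\cdot)$ lower semicontinuous for each $x$. With $Y:=]0,1[^N$, $\mathcal{Z} f(x,\xi):=\inf\{\int_Y f(x,\xi+\nabla\varphi(y))dy:\varphi\in W^{1,\infty}_0(Y;\mathbb{R}^N)\}$, where $W^{1,\infty}_0(Y;\mathbb{R}^N)$ is the set of Lipschitz maps vanishing on $\partial Y$. *)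

theory Defs
  imports "HOL-Analysis.Analysis"
begin

definition normal_integrand :: "(real^'n \<Rightarrow> real^'n^'n \<Rightarrow> ennreal) \<Rightarrow> bool" where
  "normal_integrand f \<longleftrightarrow>
     (\<lambda>z. f (fst z) (snd z)) \<in> borel_measurable borel \<and>
     (\<forall>x t. open {\<zeta>. t < f x \<zeta>})"

text \<open>W^{1,infty}_0(Y;R^N): Lipschitz maps on the closed unit cube vanishing on its boundary.\<close>
definition W1inf0 :: "(real^'n \<Rightarrow> real^'n) set" where
  "W1inf0 = {\<phi>. (\<exists>C. lipschitz_on C (cbox 0 1) \<phi>) \<and> (\<forall>y\<in>frontier (box (0::real^'n) 1). \<phi> y = 0)}"

text \<open>Z f(x,xi) = inf over phi of the integral over Y=]0,1[^N of f(x, xi + grad phi(y)),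
  grad phi being the Jacobian matrix (defined a.e. by Rademacher).\<close>
definition Zf :: "(real^'n \<Rightarrow> real^'n^'n \<Rightarrow> ennreal) \<Rightarrow> real^'n \<Rightarrow> real^'n^'n \<Rightarrow> ennreal" where
  "Zf f x \<xi> = (INF \<phi>\<in>W1inf0. (\<integral>\<^sup>+ y \<in> box 0 1. f x (\<xi> + jacobian \<phi> (at y)) \<partial>lebesgue))"

end

theory Submission
  imports Defs
begin

text \<open>
  It suffices to find a single Lipschitz map \<open>\<phi>\<close> vanishing off the unit cube whose gradient takes, almost
  everywhere, values in a finite set of invertible matrices: for \<open>M\<close> a large multiple of \<open>1 + |\<xi>|\<close>,
  the matrix \<open>\<xi> + M \<nabla>\<phi> = M (\<nabla>\<phi> + \<xi>/M)\<close> then has determinant at least \<open>\<alpha>\<close> in modulus and norm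
  at most a multiple of \<open>1 + |\<xi>|\<close>.

  Such a \<open>\<phi>\<close> is obtained by adding rank-one gradients. Suppose that the current gradient on an open
  set is a singular matrix \<open>A\<close>, and choose \<open>w \<noteq> 0\<close> in its kernel and \<open>a\<close> outside its range. Tile the
  set by cubes having \<open>w\<close> along a main diagonal and add \<open>t a\<close>, where \<open>t\<close> is the
  sup-norm distance to the boundary of the tile. On each open pyramid of each tile the gradient becomes
  \<open>A + a \<otimes> n\<close> with \<open>n \<bullet> w \<noteq> 0\<close>, whose kernel is strictly smaller, and the construction is repeated
  there. It ends after finitely many steps.
\<close>

section \<open>Gluing Lipschitz maps with disjoint supports\<close>

text \<open>If \<open>x\<close> and \<open>y\<close> lie in different pieces, each of
  \<open>g x\<close>, \<open>g y\<close> is compared with the zero value of its own map at the other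
  point, and the two estimates add up to the factor 2. The constant does not depend on the number of
  pieces, so infinite tilings are allowed.\<close>

lemma lipschitz_glue:
  fixes \<phi> :: "'i \<Rightarrow> 'a::metric_space \<Rightarrow> 'b::real_normed_vector"
  assumes lip: "\<And>j. j \<in> J \<Longrightarrow> L-lipschitz_on UNIV (\<phi> j)"
    and zero: "\<And>j y. j \<in> J \<Longrightarrow> y \<notin> U j \<Longrightarrow> \<phi> j y = 0"
    and disj: "disjoint_family_on U J" and L: "0 \<le> L"
  obtains g where "(2*L)-lipschitz_on UNIV g"
    and "\<And>j y. j \<in> J \<Longrightarrow> y \<in> U j \<Longrightarrow> g y = \<phi> j y"
    and "\<And>y. y \<notin> \<Union>(U ` J) \<Longrightarrow> g y = 0"
proof
  define g where "g y = (if \<exists>j\<in>J. y \<in> U j then \<phi> (SOME j. j \<in> J \<and> y \<in> U j) y else 0)" for y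
  show g_eq: "g y = \<phi> j y" if "j \<in> J" "y \<in> U j" for j y
  proof -
    have "(SOME j. j \<in> J \<and> y \<in> U j) = j"
      using that disj by (intro some_equality) (auto simp: disjoint_family_on_def)
    then show ?thesis using that by (auto simp: g_def)
  qed
  show g_zero: "g y = 0" if "y \<notin> \<Union>(U ` J)" for y
    using that by (auto simp: g_def)
  have lipD: "norm (\<phi> j x - \<phi> j y) \<le> L * dist x y" if "j \<in> J" for j x y
    using lipschitz_onD[OF lip[OF that], of x y] by (simp add: dist_norm)
  show "(2*L)-lipschitz_on UNIV g"
  proof (rule lipschitz_onI)
    fix x y :: 'a
    have D: "0 \<le> L * dist x y" using L by simp
    have one: "norm (g u - \<phi> j v) \<le> L * dist u v" if "j \<in> J" "u \<in> U j" for j u v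
      using g_eq[OF that] lipD[OF that(1)] by simp
    consider (none) "x \<notin> \<Union>(U ` J)" "y \<notin> \<Union>(U ` J)"
      | (x) j where "j \<in> J" "x \<in> U j" "y \<notin> \<Union>(U ` J)"
      | (y) j where "j \<in> J" "y \<in> U j" "x \<notin> \<Union>(U ` J)"
      | (both) j k where "j \<in> J" "x \<in> U j" "k \<in> J" "y \<in> U k"
      by blast
    then show "dist (g x) (g y) \<le> 2 * L * dist x y"
    proof cases
      case none
      then show ?thesis using D by (simp add: g_zero)
    next
      case (x j)
      then show ?thesis using one[of j x y] zero[of j y] g_zero[of y] D by (auto simp: dist_norm)
    next
      case (y j)
      then show ?thesis using one[of j y x] zero[of j x] g_zero[of x] D
        by (auto simp: dist_norm[of "g x"] dist_commute[of x y])
    next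
      case (both j k)
      show ?thesis
      proof (cases "j = k")
        case True
        then show ?thesis using both lipD[of j x y] g_eq[of j x] g_eq[of j y] D by (simp add: dist_norm)
      next
        case False
        then have "y \<notin> U j" "x \<notin> U k" using both disj by (auto simp: disjoint_family_on_def)
        then have "norm (g x) \<le> L * dist x y" "norm (g y) \<le> L * dist x y"
          using one[of j x y] one[of k y x] both zero by (auto simp: dist_commute)
        then show ?thesis
          using norm_triangle_ineq4[of "g x" "g y"] by (simp add: dist_norm)
      qed
    qed
  qed (use L in simp)
qed

section \<open>Sup-norm tents and their pyramids\<close>

lemma finite_type_attains_max:
  fixes f :: "'n::finite \<Rightarrow> 'a::linorder"
  obtains i where "\<And>k. f k \<le> f i"
proof -
  have "Max (range f) \<in> range f" by (intro Max_in) auto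
  then obtain i where "Max (range f) = f i" by blast
  then show thesis using that[of i] Max_ge[of "range f"] by auto
qed

lemma infnorm_eq_component:
  fixes x :: "real^'n"
  assumes "\<And>k. \<bar>x $ k\<bar> \<le> \<bar>x $ i\<bar>"
  shows "infnorm x = \<bar>x $ i\<bar>"
proof -
  have "Sup {\<bar>x $ k\<bar> |k. k \<in> UNIV} = \<bar>x $ i\<bar>"
    using assms by (intro cSup_eq_maximum) auto
  then show ?thesis by (simp add: infnorm_cart)
qed

lemma infnorm_less_iff:
  fixes x :: "real^'n"
  shows "infnorm x < r \<longleftrightarrow> (\<forall>i. \<bar>x $ i\<bar> < r)"
proof
  show "\<forall>i. \<bar>x $ i\<bar> < r" if "infnorm x < r"
    using that component_le_infnorm_cart le_less_trans by blast
  obtain i where i: "\<And>k. \<bar>x $ k\<bar> \<le> \<bar>x $ i\<bar>"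
    using finite_type_attains_max[of "\<lambda>k. \<bar>x $ k\<bar>"] by blast
  show "infnorm x < r" if "\<forall>i. \<bar>x $ i\<bar> < r"
    using that infnorm_eq_component[OF i] by simp
qed

text \<open>The gradients of a sup-norm tent on its open pyramids.\<close>

definition cube_slopes :: "(real^'n) set" where
  "cube_slopes = (\<Union>i. {axis i 1, axis i (-1)})"

lemma finite_cube_slopes: "finite cube_slopes"
  by (simp add: cube_slopes_def)

text \<open>Inside the cube with centre \<open>c\<close> and half-side \<open>r\<close> the tent is
  the sup-norm distance to the boundary; \<open>max 0\<close> extends it by zero. The constant is 1
  because the sup norm is at most the Euclidean norm.\<close>

lemma lipschitz_tent: "1-lipschitz_on UNIV (\<lambda>y::'a::euclidean_space. max 0 (r - infnorm (y - c)))"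
proof (rule lipschitz_onI)
  fix x y :: 'a
  have "\<bar>infnorm (x - c) - infnorm (y - c)\<bar> \<le> norm (x - y)"
    using absdiff_infnorm[of "x - c" "y - c"] infnorm_le_norm[of "x - y"] by simp
  then show "dist (max 0 (r - infnorm (x - c))) (max 0 (r - infnorm (y - c))) \<le> 1 * dist x y"
    by (simp add: dist_norm)
qed simp

text \<open>On the open pyramid where coordinate \<open>i\<close> strictly dominates with constant
  sign, the sup norm is a single signed coordinate. A whole neighbourhood is produced, not just a
  derivative at \<open>y\<close>, because the next stage needs open sets of constant
  gradient.\<close>

lemma tent_locally_affine:
  fixes c y :: "real^'n"
  assumes "infnorm (y - c) < r" and "y $ i \<noteq> c $ i"
    and "\<And>k. k \<noteq> i \<Longrightarrow> \<bar>y $ k - c $ k\<bar> < \<bar>y $ i - c $ i\<bar>"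
  obtains W n where "open W" "y \<in> W" "n \<in> cube_slopes"
    and "\<And>z. z \<in> W \<Longrightarrow> max 0 (r - infnorm (z - c)) = r + n \<bullet> (z - c)"
proof
  define s where "s = sgn (y $ i - c $ i)"
  define W where "W = {z. 0 < s * (z $ i - c $ i)} \<inter> {z. s * (z $ i - c $ i) < r} \<inter>
    (\<Inter>k\<in>-{i}. {z. \<bar>z $ k - c $ k\<bar> < s * (z $ i - c $ i)})"
  have s: "s = 1 \<or> s = -1" using assms(2) by (auto simp: s_def sgn_if)
  have abs: "s * (y $ i - c $ i) = \<bar>y $ i - c $ i\<bar>" by (simp add: s_def abs_sgn mult.commute)
  show "open W" unfolding W_def
    by (intro open_Int open_INT open_Collect_less ballI continuous_intros) auto
  show "y \<in> W"
    using assms infnorm_less_iff[of "y - c" r] by (auto simp: W_def abs)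
  show "axis i (- s) \<in> (cube_slopes :: (real^'n) set)"
    using s by (force simp: cube_slopes_def)
  fix z assume z: "z \<in> W"
  then have zi: "\<bar>z $ i - c $ i\<bar> = s * (z $ i - c $ i)" using s by (auto simp: W_def)
  have "infnorm (z - c) = \<bar>(z - c) $ i\<bar>"
  proof (rule infnorm_eq_component)
    fix k show "\<bar>(z - c) $ k\<bar> \<le> \<bar>(z - c) $ i\<bar>"
      using z zi by (cases "k = i") (auto simp: W_def intro: less_imp_le)
  qed
  then show "max 0 (r - infnorm (z - c)) = r + axis i (- s) \<bullet> (z - c)"
    using z zi by (auto simp: W_def inner_axis')
qed

text \<open>Off the pyramids, either \<open>y\<close> is the centre or two coordinates of
  \<open>y - c\<close> tie in modulus, so \<open>y\<close> lies on one of finitely many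
  hyperplanes.\<close>

lemma negligible_pyramid_walls:
  fixes c :: "real^'n"
  shows "negligible {y. \<not> (\<exists>i. y $ i \<noteq> c $ i \<and> (\<forall>k. k \<noteq> i \<longrightarrow> \<bar>y $ k - c $ k\<bar> < \<bar>y $ i - c $ i\<bar>))}"
    (is "negligible ?B")
proof -
  have hyp: "negligible {y::real^'n. a \<bullet> (y - c) = 0}" if "a \<noteq> 0" for a
    using negligible_hyperplane[of a "a \<bullet> c"] that by (simp add: inner_diff_right)
  \<comment> \<open>The inserted hyperplane, for an arbitrary index, catches the centre; it is the
    only member when N = 1, where no pair \<open>i \<noteq> k\<close> exists.\<close>
  define A where "A = insert {y::real^'n. y $ undefined - c $ undefined = 0}
     ((\<lambda>(i,k,s). {y::real^'n. y $ i - c $ i + s * (y $ k - c $ k) = 0}) ` {(i,k,s). i \<noteq> k \<and> s \<in> {1,-1}})"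
  have "finite {(i::'n,k::'n,s::real). i \<noteq> k \<and> s \<in> {1,-1}}"
    by (rule finite_subset[of _ "UNIV \<times> UNIV \<times> {1,-1}"]) auto
  moreover have "negligible {y::real^'n. y $ i - c $ i + s * (y $ k - c $ k) = 0}" if "i \<noteq> k" for i k s
  proof -
    have "(axis i 1 + axis k s :: real^'n) \<noteq> 0"
      using that by (auto simp: vec_eq_iff axis_def intro!: exI[of _ i])
    from hyp[OF this] show ?thesis by (simp add: inner_add_left inner_axis')
  qed
  moreover have "negligible {y::real^'n. y $ i - c $ i = 0}" for i
    using hyp[of "axis i 1"] by (simp add: inner_axis' axis_eq_0_iff)
  ultimately have "negligible (\<Union>A)"
    unfolding A_def by (intro negligible_Union) auto
  moreover have "?B \<subseteq> \<Union>A"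
  proof
    fix y assume y: "y \<in> ?B"
    obtain i where i: "\<And>k. \<bar>y $ k - c $ k\<bar> \<le> \<bar>y $ i - c $ i\<bar>"
      using finite_type_attains_max[of "\<lambda>k. \<bar>y $ k - c $ k\<bar>"] by blast
    show "y \<in> \<Union>A"
    proof (cases "y $ i = c $ i")
      case True
      then have "y $ undefined - c $ undefined = 0" using i[of undefined] by simp
      then show ?thesis by (simp add: A_def)
    next
      case False
      with y obtain k where k: "k \<noteq> i" "\<not> \<bar>y $ k - c $ k\<bar> < \<bar>y $ i - c $ i\<bar>" by blast
      with i[of k] have "\<bar>y $ k - c $ k\<bar> = \<bar>y $ i - c $ i\<bar>" by simp
      then have "y $ i - c $ i + 1 * (y $ k - c $ k) = 0 \<or> y $ i - c $ i + (-1) * (y $ k - c $ k) = 0"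
        by (auto simp: abs_if split: if_splits)
      then show ?thesis using k(1) unfolding A_def
        by (elim disjE) (force intro!: bexI[of _ "(i,k,1)"], force intro!: bexI[of _ "(i,k,-1)"])
    qed
  qed
  ultimately show ?thesis by (rule negligible_subset)
qed

section \<open>Tiling bounded open sets by cubes\<close>

text \<open>Dyadic subdivision of a cube divides all its sides by the same power of 2, so the cells
  given by \<open>covering_lemma\<close> are again cubes, that is, sup-norm balls.\<close>

lemma bounded_open_cube_tiling:
  fixes U :: "(real^'n) set"
  assumes "open U" "bounded U"
  obtains \<D> c r where "countable \<D>" "pairwise (\<lambda>A B. interior A \<inter> interior B = {}) \<D>"
    and "\<Union>\<D> = U" "\<And>K. K \<in> \<D> \<Longrightarrow> interior K = {y. infnorm (y - c K) < r K}"
    and "\<And>K. K \<in> \<D> \<Longrightarrow> negligible (K - interior K)"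
proof -
  obtain B where B: "B > 0" "\<And>x. x \<in> U \<Longrightarrow> norm x \<le> B"
    using assms(2) bounded_pos by blast
  define b :: "real^'n" where "b = (\<chi> i. B)"
  \<comment> \<open>Each cell contains some \<open>x \<in> U\<close> and lies in
    \<open>g x = U\<close>, so the cells fill exactly \<open>U\<close>.\<close>
  define g where "g x = (if x \<in> U then U else UNIV)" for x
  have "U \<subseteq> cbox (-b) b"
  proof
    fix x assume "x \<in> U"
    then have "\<bar>x $ i\<bar> \<le> B" for i using B(2) component_le_norm_cart order_trans by blast
    then show "x \<in> cbox (-b) b" by (auto simp: b_def mem_box_cart abs_le_iff minus_le_iff)
  qed
  moreover have "box (-b) b \<noteq> {}"
    using B(1) by (simp add: interval_ne_empty_cart b_def)
  moreover have "gauge g" using assms(1) by (auto simp: gauge_def g_def)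
  ultimately obtain \<D> where D: "countable \<D>"
    "\<And>K. K \<in> \<D> \<Longrightarrow> interior K \<noteq> {} \<and> (\<exists>c d. K = cbox c d)"
    "pairwise (\<lambda>A B. interior A \<inter> interior B = {}) \<D>"
    "\<And>K. K \<in> \<D> \<Longrightarrow> \<exists>x \<in> U \<inter> K. K \<subseteq> g x"
    "\<And>u v. cbox u v \<in> \<D> \<Longrightarrow> \<exists>n. \<forall>i \<in> Basis. v \<bullet> i - u \<bullet> i = (b \<bullet> i - (-b) \<bullet> i) / 2^n"
    "U \<subseteq> \<Union>\<D>"
    by (rule covering_lemma) (rule that, assumption+)
  have "\<exists>c r. interior K = {y. infnorm (y - c) < r}" if K: "K \<in> \<D>" for K
  proof -
    obtain u v where uv: "K = cbox u v" using D(2)[OF K] by blast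
    then obtain n where n: "\<forall>i \<in> Basis. v \<bullet> i - u \<bullet> i = (b \<bullet> i - (-b) \<bullet> i) / 2^n"
      using D(5) K by blast
    have side: "v $ i - u $ i = 2 * B / 2^n" for i
      using n[rule_format, of "axis i 1"] by (simp add: inner_axis b_def axis_in_Basis_iff)
    have "y \<in> box u v \<longleftrightarrow> infnorm (y - (1/2) *\<^sub>R (u + v)) < B / 2^n" for y
    proof -
      have "u $ i < y $ i \<and> y $ i < v $ i \<longleftrightarrow> \<bar>(y - (1/2) *\<^sub>R (u + v)) $ i\<bar> < B / 2^n" for i
      proof -
        have "v $ i = u $ i + 2 * (B / 2^n)" using side[of i] by simp
        moreover have "(y - (1/2) *\<^sub>R (u + v)) $ i = y $ i - (u $ i + v $ i) / 2" by simp
        ultimately show ?thesis unfolding abs_less_iff by argo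
      qed
      then show ?thesis by (simp add: infnorm_less_iff mem_box_cart)
    qed
    then show ?thesis unfolding uv interior_cbox by blast
  qed
  then obtain c r where "\<And>K. K \<in> \<D> \<Longrightarrow> interior K = {y. infnorm (y - c K) < r K}" by metis
  moreover have "\<Union>\<D> = U"
    using D(4,6) by (fastforce simp: g_def)
  moreover have "negligible (K - interior K)" if "K \<in> \<D>" for K
    using D(2)[OF that] by (metis interior_cbox negligible_frontier_interval)
  ultimately show thesis using that D(1,3) by blast
qed

section \<open>Scalar functions with prescribed slopes\<close>

text \<open>Taking the interior makes the region with slope \<open>n\<close> open up to a null set,
  so the construction can be repeated inside it. The Lipschitz constant 2, the same for every
  \<open>U\<close>, is what gluing 1-Lipschitz tents yields.\<close>

definition realizable_slopes :: "(real^'n) set \<Rightarrow> bool" where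
  "realizable_slopes F \<longleftrightarrow> (\<forall>U. open U \<longrightarrow> bounded U \<longrightarrow>
     (\<exists>t. 2-lipschitz_on UNIV t \<and> (\<forall>y. y \<notin> U \<longrightarrow> t y = 0) \<and>
       negligible {y \<in> U. \<not> (\<exists>n\<in>F.
         y \<in> interior {z \<in> U. (t has_derivative (\<lambda>h. n \<bullet> h)) (at z)})}))"

text \<open>Tents on the cells of a tiling are glued. The exceptional set consists of the cell
  boundaries and the pyramid walls, a countable union of negligible sets.\<close>

lemma realizable_cube_slopes: "realizable_slopes (cube_slopes :: (real^'n) set)"
  unfolding realizable_slopes_def
proof (intro allI impI)
  fix U :: "(real^'n) set"
  assume U: "open U" "bounded U"
  obtain \<D> c r where D: "countable \<D>" "pairwise (\<lambda>A B. interior A \<inter> interior B = {}) \<D>"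
    "\<Union>\<D> = U" "\<And>K. K \<in> \<D> \<Longrightarrow> interior K = {y. infnorm (y - c K) < r K}"
    "\<And>K. K \<in> \<D> \<Longrightarrow> negligible (K - interior K)"
    using bounded_open_cube_tiling[OF U] by metis
  have disj: "disjoint_family_on interior \<D>"
    using D(2) by (auto simp: disjoint_family_on_def pairwise_def)
  obtain t where lip: "(2*1)-lipschitz_on UNIV t"
    and t_eq: "\<And>K y. K \<in> \<D> \<Longrightarrow> y \<in> interior K \<Longrightarrow> t y = max 0 (r K - infnorm (y - c K))"
    and t_0: "\<And>y. y \<notin> \<Union>(interior ` \<D>) \<Longrightarrow> t y = 0"
    by (rule lipschitz_glue[where J = \<D> and U = interior and L = 1 and
          \<phi> = "\<lambda>K y. max 0 (r K - infnorm (y - c K))", OF lipschitz_tent])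
       (use disj in \<open>auto simp: D(4)\<close>)
  define Z where "Z = \<Union>((\<lambda>K. K - interior K) ` \<D>) \<union> \<Union>((\<lambda>K. {y. \<not> (\<exists>i. y $ i \<noteq> c K $ i \<and>
       (\<forall>k. k \<noteq> i \<longrightarrow> \<bar>y $ k - c K $ k\<bar> < \<bar>y $ i - c K $ i\<bar>))}) ` \<D>)"
  have "negligible Z"
    unfolding Z_def using D(1,5) negligible_pyramid_walls
    by (intro negligible_Un negligible_countable_Union) auto
  moreover have "\<exists>n\<in>cube_slopes. y \<in> interior {z \<in> U. (t has_derivative (\<lambda>h. n \<bullet> h)) (at z)}"
    if y: "y \<in> U" "y \<notin> Z" for y
  proof -
    obtain K where K: "K \<in> \<D>" "y \<in> interior K" using y D(3) by (auto simp: Z_def)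
    then obtain i where i: "y $ i \<noteq> c K $ i"
      "\<And>k. k \<noteq> i \<Longrightarrow> \<bar>y $ k - c K $ k\<bar> < \<bar>y $ i - c K $ i\<bar>"
      using y(2) unfolding Z_def by blast
    have yr: "infnorm (y - c K) < r K" using K D(4) by blast
    obtain W n where W: "open W" "y \<in> W" "n \<in> cube_slopes"
      "\<And>z. z \<in> W \<Longrightarrow> max 0 (r K - infnorm (z - c K)) = r K + n \<bullet> (z - c K)"
      using tent_locally_affine[OF yr i] by metis
    have "(t has_derivative (\<lambda>h. n \<bullet> h)) (at z)" if "z \<in> W \<inter> interior K" for z
    proof (rule has_derivative_transform_within_open[of "\<lambda>z. r K + n \<bullet> (z - c K)" _ _ _ "W \<inter> interior K"])
      show "((\<lambda>z. r K + n \<bullet> (z - c K)) has_derivative (\<lambda>h. n \<bullet> h)) (at z)"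
        by (auto intro!: derivative_eq_intros)
    qed (use W that K t_eq in auto)
    then have "W \<inter> interior K \<subseteq> interior {z \<in> U. (t has_derivative (\<lambda>h. n \<bullet> h)) (at z)}"
      using W(1) D(3) K(1) interior_subset by (intro interior_maximal) auto
    then show ?thesis using W K by blast
  qed
  ultimately have "negligible {y \<in> U. \<not> (\<exists>n\<in>cube_slopes.
            y \<in> interior {z \<in> U. (t has_derivative (\<lambda>h. n \<bullet> h)) (at z)})}"
    by (elim negligible_subset) blast
  moreover have "t y = 0" if "y \<notin> U" for y
    using that D(3) interior_subset by (intro t_0) blast
  ultimately show "\<exists>t. 2-lipschitz_on UNIV t \<and> (\<forall>y. y \<notin> U \<longrightarrow> t y = 0) \<and>
      negligible {y \<in> U. \<not> (\<exists>n\<in>cube_slopes.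
        y \<in> interior {z \<in> U. (t has_derivative (\<lambda>h. n \<bullet> h)) (at z)})}"
    using lip by auto
qed

text \<open>Rotating the tiles so that \<open>w\<close> becomes a multiple of a main diagonal of the cubes makes
  every slope transversal to \<open>w\<close>.\<close>

lemma transversal_realizable_slopes:
  fixes w :: "real^'n"
  assumes "w \<noteq> 0"
  obtains F where "finite F" "\<And>n. n \<in> F \<Longrightarrow> n \<bullet> w \<noteq> 0"
    and "realizable_slopes F"
proof -
  \<comment> \<open>The main diagonal has inner product 1 or -1 with every cube slope; an orthogonal
    \<open>g\<close> carrying its direction to that of \<open>w\<close> preserves these products up
    to the positive factor \<open>norm w / norm d\<close>.\<close>
  define d :: "real^'n" where "d = (\<chi> i. 1)"
  have "d \<noteq> 0" by (simp add: d_def vec_eq_iff)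
  have "norm ((norm w / norm d) *\<^sub>R d) = norm w" using \<open>d \<noteq> 0\<close> by simp
  then obtain g where g: "orthogonal_transformation g" "g ((norm w / norm d) *\<^sub>R d) = w"
    using orthogonal_transformation_exists by blast
  have lin: "linear g" and inner: "\<And>x y. g x \<bullet> g y = x \<bullet> y"
    using g(1) by (auto simp: orthogonal_transformation_def)
  have bij: "bij g" using g(1) orthogonal_transformation_bij by blast
  define h where "h = inv g"
  have gh: "g (h x) = x" and hg: "h (g x) = x" for x
    using bij by (simp_all add: h_def bij_is_surj surj_f_inv_f bij_is_inj)
  have orth_h: "orthogonal_transformation h"
    unfolding h_def using g(1) orthogonal_transformation_inv by blast
  have lin_h: "linear h" using orth_h by (simp add: orthogonal_transformation_def)
  \<comment> \<open>The inverse of an orthogonal map is its adjoint, so composing with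
    \<open>h\<close> turns the slope \<open>n\<close> into \<open>g n\<close>.\<close>
  have n_h: "n \<bullet> h x = g n \<bullet> x" for n x using inner[of n "h x"] by (simp add: gh)
  show thesis
  proof (rule that[of "g ` cube_slopes"])
    show "finite (g ` cube_slopes)" by (simp add: finite_cube_slopes)
    show "n \<bullet> w \<noteq> 0" if n: "n \<in> g ` cube_slopes" for n
    proof -
      obtain i where "n = g (axis i 1) \<or> n = g (axis i (-1))"
        using n unfolding cube_slopes_def by blast
      then obtain s where "n = g (axis i s)" and s: "s \<in> {1, -1}" by blast
      then have "n \<bullet> w = s * (norm w / norm d)"
        using inner[of "axis i s" "(norm w / norm d) *\<^sub>R d"] g(2) by (simp add: inner_axis' d_def)
      then show ?thesis using s \<open>w \<noteq> 0\<close> \<open>d \<noteq> 0\<close> by auto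
    qed
    show "realizable_slopes (g ` cube_slopes)"
      unfolding realizable_slopes_def
    proof (intro allI impI)
      fix U :: "(real^'n) set" assume U: "open U" "bounded U"
      have "g -` U = h ` U" using gh hg by (auto simp: image_iff) metis
      have "open (g -` U)"
        using U(1) lin by (simp add: open_vimage linear_continuous_on linear_conv_bounded_linear)
      moreover have "bounded (g -` U)"
        unfolding \<open>g -` U = h ` U\<close>
        using U(2) lin_h by (simp add: bounded_linear_image linear_conv_bounded_linear)
      ultimately obtain t where t: "2-lipschitz_on UNIV t" "\<And>y. y \<notin> g -` U \<Longrightarrow> t y = 0"
        "negligible {y \<in> g -` U. \<not> (\<exists>n\<in>cube_slopes.
              y \<in> interior {z \<in> g -` U. (t has_derivative (\<lambda>h. n \<bullet> h)) (at z)})}" (is "negligible ?Z")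
        using realizable_cube_slopes unfolding realizable_slopes_def by blast
      have "2-lipschitz_on UNIV (\<lambda>y. t (h y))"
      proof (rule lipschitz_onI)
        fix x y
        have "dist (h x) (h y) = dist x y"
          using orth_h by (simp add: orthogonal_transformation_isometry)
        then show "dist (t (h x)) (t (h y)) \<le> 2 * dist x y"
          using lipschitz_onD[OF t(1), of "h x" "h y"] by simp
      qed simp
      moreover have "t (h y) = 0" if "y \<notin> U" for y
        using that by (simp add: t(2) gh)
      \<comment> \<open>Since \<open>g\<close> is an open map, interiors are transported, and every
        bad point of the composed function is the image of a bad point of \<open>t\<close>.\<close>
      moreover have "y \<in> g ` ?Z" if y: "y \<in> U" and
        bad: "\<not> (\<exists>n\<in>g ` cube_slopes. y \<in> interior {z \<in> U. ((\<lambda>y. t (h y)) has_derivative (\<lambda>h. n \<bullet> h)) (at z)})" for y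
      proof -
        have "h y \<notin> interior {z \<in> g -` U. (t has_derivative (\<lambda>h. n \<bullet> h)) (at z)}" (is "h y \<notin> interior ?A")
          if n: "n \<in> cube_slopes" for n
        proof
          assume hy: "h y \<in> interior ?A"
          have "((\<lambda>y. t (h y)) has_derivative (\<lambda>v. g n \<bullet> v)) (at (g z))" if "z \<in> ?A" for z
          proof -
            have "(h has_derivative h) (at (g z))"
              using lin_h by (simp add: linear_imp_has_derivative)
            moreover have "(t has_derivative (\<lambda>h. n \<bullet> h)) (at (h (g z)))" using that by (simp add: hg)
            ultimately have "((\<lambda>y. t (h y)) has_derivative (\<lambda>v. n \<bullet> h v)) (at (g z))"
              by (rule has_derivative_compose)
            then show ?thesis by (simp add: n_h)
          qed
          then have "g ` interior ?A \<subseteq> {z \<in> U. ((\<lambda>y. t (h y)) has_derivative (\<lambda>v. g n \<bullet> v)) (at z)}"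
            using interior_subset by blast
          moreover have "open (g ` interior ?A)"
            using open_surjective_linear_image[OF open_interior lin] bij by (simp add: bij_is_surj)
          ultimately have "g ` interior ?A \<subseteq> interior {z \<in> U. ((\<lambda>y. t (h y)) has_derivative (\<lambda>v. g n \<bullet> v)) (at z)}"
            by (rule interior_maximal)
          moreover have "y \<in> g ` interior ?A" by (rule image_eqI[where f = g and x = "h y", OF gh[symmetric] hy])
          ultimately show False using bad n by blast
        qed
        then have hy: "h y \<in> ?Z" using y by (auto simp: gh)
        show ?thesis by (rule image_eqI[where f = g and x = "h y", OF gh[symmetric] hy])
      qed
      moreover have "negligible (g ` ?Z)"
        using t(3) lin
        by (intro negligible_differentiable_image_negligible) (auto intro: linear_imp_differentiable_on)
      ultimately show "\<exists>t. 2-lipschitz_on UNIV t \<and> (\<forall>y. y \<notin> U \<longrightarrow> t y = 0) \<and>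
            negligible {y \<in> U. \<not> (\<exists>n\<in>g ` cube_slopes. y \<in> interior {z \<in> U. (t has_derivative (\<lambda>h. n \<bullet> h)) (at z)})}"
        by (intro exI[of _ "\<lambda>y. t (h y)"] conjI) (auto elim!: negligible_subset)
    qed
  qed
qed

section \<open>Rank-one updates and the differential inclusion\<close>

lemma rank_one_update_mult:
  "(A + (\<chi> i j. a $ i * n $ j)) *v h = A *v h + (n \<bullet> h) *\<^sub>R a" for A :: "real^'n^'m"
  by (simp add: vec_eq_iff matrix_vector_mult_def inner_vec_def algebra_simps
      sum.distrib sum_distrib_left)

text \<open>The map sending \<open>y\<close> to \<open>A *v y + \<phi> y\<close> has linear boundary
  data and gradient almost everywhere in a finite set of invertible matrices. \<open>L\<close> and
  \<open>K\<close> are fixed before \<open>U\<close>, so that solutions on different open sets can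
  be glued.\<close>

definition nonsingular_inclusion :: "real^'n^'n \<Rightarrow> bool" where
  "nonsingular_inclusion A \<longleftrightarrow> (\<exists>L\<ge>0. \<exists>K. finite K \<and> (\<forall>B\<in>K. det B \<noteq> 0) \<and>
     (\<forall>U. open U \<longrightarrow> bounded U \<longrightarrow> (\<exists>\<phi>. L-lipschitz_on UNIV \<phi> \<and> (\<forall>y. y \<notin> U \<longrightarrow> \<phi> y = 0) \<and>
        negligible {y \<in> U. \<not> (\<exists>B\<in>K. (\<phi> has_derivative (\<lambda>h. (B - A) *v h)) (at y))})))"

text \<open>First \<open>t a\<close> moves the gradient from \<open>A\<close> to
  \<open>A + a \<otimes> n\<close> on an open set \<open>V n\<close>; there a solution of the
  inclusion for the new matrix is added. The bound \<open>2 * M\<close> comes from gluing these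
  solutions, and \<open>2 * norm a\<close> from \<open>t a\<close>.\<close>

lemma nonsingular_inclusion_rank_one_step:
  fixes A :: "real^'n^'n"
  assumes "finite F" and "\<And>n. n \<in> F \<Longrightarrow> nonsingular_inclusion (A + (\<chi> i j. a $ i * n $ j))"
    and slopes: "realizable_slopes F"
  shows "nonsingular_inclusion A"
proof -
  define A' where "A' n = A + (\<chi> i j. a $ i * n $ j)" for n
  have A'_mult: "A' n *v h = A *v h + (n \<bullet> h) *\<^sub>R a" for n h
    by (simp add: A'_def rank_one_update_mult)
  define P where "P n L K \<longleftrightarrow> 0 \<le> L \<and> finite K \<and> (\<forall>B\<in>K. det B \<noteq> 0) \<and>
     (\<forall>U. open U \<longrightarrow> bounded U \<longrightarrow> (\<exists>\<phi>. L-lipschitz_on UNIV \<phi> \<and> (\<forall>y. y \<notin> U \<longrightarrow> \<phi> y = 0) \<and>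
        negligible {y \<in> U. \<not> (\<exists>B\<in>K. (\<phi> has_derivative (\<lambda>h. (B - A' n) *v h)) (at y))}))"
    for n L K
  have "\<exists>L K. P n L K" if "n \<in> F" for n
    using assms(2)[OF that] unfolding nonsingular_inclusion_def P_def A'_def by blast
  then obtain L K where P: "\<And>n. n \<in> F \<Longrightarrow> P n (L n) (K n)" by metis
  have L: "L n \<ge> 0" and K: "finite (K n)" "\<And>B. B \<in> K n \<Longrightarrow> det B \<noteq> 0"
    and IH: "\<And>U. open U \<Longrightarrow> bounded U \<Longrightarrow> \<exists>\<phi>. (L n)-lipschitz_on UNIV \<phi> \<and> (\<forall>y. y \<notin> U \<longrightarrow> \<phi> y = 0) \<and>
        negligible {y \<in> U. \<not> (\<exists>B\<in>K n. (\<phi> has_derivative (\<lambda>h. (B - A' n) *v h)) (at y))}"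
    if "n \<in> F" for n
    using P[OF that] unfolding P_def by blast+
  define M where "M = (\<Sum>n\<in>F. L n)"
  have M: "M \<ge> 0" "\<And>n. n \<in> F \<Longrightarrow> L n \<le> M"
    using L assms(1) by (auto simp: M_def intro: sum_nonneg member_le_sum)
  show ?thesis
    unfolding nonsingular_inclusion_def
  proof (intro exI[of _ "2 * M + 2 * norm a"] exI[of _ "\<Union>(K ` F)"] conjI allI impI)
    show "0 \<le> 2 * M + 2 * norm a" using M by simp
    show "finite (\<Union>(K ` F))" using K(1) assms(1) by blast
    show "\<forall>B\<in>\<Union>(K ` F). det B \<noteq> 0" using K(2) by blast
    fix U :: "(real^'n) set" assume U: "open U" "bounded U"
    obtain t where t: "2-lipschitz_on UNIV t" "\<And>y. y \<notin> U \<Longrightarrow> t y = 0"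
      "negligible {y \<in> U. \<not> (\<exists>n\<in>F. y \<in> interior {z \<in> U. (t has_derivative (\<lambda>h. n \<bullet> h)) (at z)})}"
      (is "negligible ?Z")
      using slopes U unfolding realizable_slopes_def by blast
    define V where "V n = interior {z \<in> U. (t has_derivative (\<lambda>h. n \<bullet> h)) (at z)}" for n
    have VU: "V n \<subseteq> U" and Vt: "\<And>y. y \<in> V n \<Longrightarrow> (t has_derivative (\<lambda>h. n \<bullet> h)) (at y)" for n
      using interior_subset unfolding V_def by blast+
    have V: "open (V n)" "bounded (V n)" for n
      using bounded_subset[OF U(2) VU] by (auto simp: V_def)
    \<comment> \<open>A point in two of these sets would give \<open>t\<close> two different
      derivatives.\<close>
    have disj: "disjoint_family_on V F"
      unfolding disjoint_family_on_def
    proof (intro ballI impI equals0I)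
      fix m n y assume "m \<noteq> n" "y \<in> V m \<inter> V n"
      then have "(\<lambda>h. m \<bullet> h) = (\<lambda>h. n \<bullet> h)" using Vt has_derivative_unique by blast
      then show False using \<open>m \<noteq> n\<close> vector_eq_rdot by metis
    qed
    have "\<forall>n\<in>F. \<exists>\<psi>. (L n)-lipschitz_on UNIV \<psi> \<and> (\<forall>y. y \<notin> V n \<longrightarrow> \<psi> y = 0) \<and>
        negligible {y \<in> V n. \<not> (\<exists>B\<in>K n. (\<psi> has_derivative (\<lambda>h. (B - A' n) *v h)) (at y))}"
      using IH[OF _ V] by blast
    from bchoice[OF this] obtain \<psi> where \<psi>: "\<And>n. n \<in> F \<Longrightarrow> (L n)-lipschitz_on UNIV (\<psi> n)"
      "\<And>n y. n \<in> F \<Longrightarrow> y \<notin> V n \<Longrightarrow> \<psi> n y = 0"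
      "\<And>n. n \<in> F \<Longrightarrow> negligible {y \<in> V n. \<not> (\<exists>B\<in>K n. (\<psi> n has_derivative (\<lambda>h. (B - A' n) *v h)) (at y))}"
      by blast
    have lipM: "M-lipschitz_on UNIV (\<psi> n)" if "n \<in> F" for n
      using that by (intro lipschitz_on_le[OF \<psi>(1) M(2)])
    obtain g where g: "(2*M)-lipschitz_on UNIV g"
      "\<And>n y. n \<in> F \<Longrightarrow> y \<in> V n \<Longrightarrow> g y = \<psi> n y" "\<And>y. y \<notin> \<Union>(V ` F) \<Longrightarrow> g y = 0"
      using lipschitz_glue[where J = F and L = M and \<phi> = \<psi> and U = V, OF lipM \<psi>(2) disj M(1)] by blast
    define \<phi> where "\<phi> y = g y + t y *\<^sub>R a" for y
    have "(2 * norm a)-lipschitz_on UNIV (\<lambda>y. t y *\<^sub>R a)"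
    proof (rule lipschitz_onI)
      fix x y
      have "norm (t x *\<^sub>R a - t y *\<^sub>R a) = dist (t x) (t y) * norm a"
        by (simp flip: scaleR_diff_left add: dist_norm)
      also have "\<dots> \<le> 2 * dist x y * norm a"
        using lipschitz_onD[OF t(1), of x y] by (intro mult_right_mono) auto
      finally show "dist (t x *\<^sub>R a) (t y *\<^sub>R a) \<le> 2 * norm a * dist x y"
        by (simp add: dist_norm mult_ac)
    qed simp
    then have "(2 * M + 2 * norm a)-lipschitz_on UNIV \<phi>"
      unfolding \<phi>_def by (intro lipschitz_on_add g(1))
    moreover have "\<phi> y = 0" if "y \<notin> U" for y
      using that VU by (auto simp: \<phi>_def t(2) intro!: g(3))
    moreover have "negligible {y \<in> U. \<not> (\<exists>B\<in>\<Union>(K ` F). (\<phi> has_derivative (\<lambda>h. (B - A) *v h)) (at y))}"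
    proof (rule negligible_subset)
      show "negligible (?Z \<union> \<Union>((\<lambda>n. {y \<in> V n. \<not> (\<exists>B\<in>K n. (\<psi> n has_derivative (\<lambda>h. (B - A' n) *v h)) (at y))}) ` F))"
        (is "negligible (?Z \<union> ?Y)")
        using t(3) \<psi>(3) assms(1) by (intro negligible_Un negligible_Union) auto
      have "\<exists>B\<in>\<Union>(K ` F). (\<phi> has_derivative (\<lambda>h. (B - A) *v h)) (at y)" if y: "y \<in> U" "y \<notin> ?Z" "y \<notin> ?Y" for y
      proof -
        obtain n where n: "n \<in> F" "y \<in> V n" using y by (auto simp: V_def)
        then obtain B where B: "B \<in> K n" "(\<psi> n has_derivative (\<lambda>h. (B - A' n) *v h)) (at y)"
          using y(3) by blast
        have "(g has_derivative (\<lambda>h. (B - A' n) *v h)) (at y)"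
          using B(2) V(1) n(2) by (rule has_derivative_transform_within_open) (simp add: g(2)[OF n(1)])
        then have "(\<phi> has_derivative (\<lambda>h. (B - A' n) *v h + (n \<bullet> h) *\<^sub>R a)) (at y)"
          unfolding \<phi>_def using Vt[OF n(2)] by (auto intro!: derivative_eq_intros)
        \<comment> \<open>The rank-one term contributed by \<open>t a\<close> is exactly
          \<open>A' n - A\<close>.\<close>
        moreover have "(B - A' n) *v h + (n \<bullet> h) *\<^sub>R a = (B - A) *v h" for h
          by (simp add: matrix_vector_mult_diff_rdistrib A'_mult)
        ultimately show ?thesis using B(1) n(1) by auto
      qed
      then show "{y \<in> U. \<not> (\<exists>B\<in>\<Union>(K ` F). (\<phi> has_derivative (\<lambda>h. (B - A) *v h)) (at y))} \<subseteq> ?Z \<union> ?Y"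
        by blast
    qed
    ultimately show "\<exists>\<phi>. (2 * M + 2 * norm a)-lipschitz_on UNIV \<phi> \<and> (\<forall>y. y \<notin> U \<longrightarrow> \<phi> y = 0) \<and>
        negligible {y \<in> U. \<not> (\<exists>B\<in>\<Union>(K ` F). (\<phi> has_derivative (\<lambda>h. (B - A) *v h)) (at y))}"
      by blast
  qed
qed

text \<open>If \<open>a\<close> is not in the range of \<open>A\<close> and \<open>n\<close> does not vanish on the kernel of \<open>A\<close>, then the
  kernel of \<open>A + a \<otimes> n\<close> is strictly smaller than that of \<open>A\<close>.\<close>

lemma nonsingular_inclusion: "nonsingular_inclusion A" for A :: "real^'n^'n"
proof (induction "dim {x. A *v x = 0}" arbitrary: A rule: less_induct)
  case less
  show ?case
  proof (cases "det A = 0")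
    case False
    show ?thesis
      unfolding nonsingular_inclusion_def
    proof (rule exI[of _ 0], intro conjI, simp, rule exI[of _ "{A}"], intro conjI allI impI)
      fix U :: "(real^'n) set"
      show "\<exists>\<phi>. 0-lipschitz_on UNIV \<phi> \<and> (\<forall>y. y \<notin> U \<longrightarrow> \<phi> y = 0) \<and>
        negligible {y \<in> U. \<not> (\<exists>B\<in>{A}. (\<phi> has_derivative (\<lambda>h. (B - A) *v h)) (at y))}"
        by (intro exI[of _ "\<lambda>_. 0"]) (auto intro: lipschitz_onI)
    qed (use False in auto)
  next
    case True
    \<comment> \<open>A singular square matrix fails both injectivity and surjectivity, which
      supplies \<open>w\<close> in the kernel and \<open>a\<close> off the range.\<close>
    then have "\<not> inj ((*v) A)" "\<not> surj ((*v) A)"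
      using det_nz_iff_inj[of "(*v) A"] linear_injective_imp_surjective linear_surjective_imp_injective
      by (auto simp: matrix_vector_mul_linear)
    then obtain w a where w: "w \<noteq> 0" "A *v w = 0" and a: "a \<notin> range ((*v) A)"
      using linear_injective_0[of "(*v) A"] by (auto simp: matrix_vector_mul_linear)
    obtain F where F: "finite F" "\<And>n. n \<in> F \<Longrightarrow> n \<bullet> w \<noteq> 0"
      and slopes: "realizable_slopes F"
      using transversal_realizable_slopes[OF w(1)] by blast
    have "nonsingular_inclusion (A + (\<chi> i j. a $ i * n $ j))" if n: "n \<in> F" for n
    proof (rule less.hyps)
      let ?A = "A + (\<chi> i j. a $ i * n $ j)"
      have A_mult: "?A *v h = A *v h + (n \<bullet> h) *\<^sub>R a" for h
        by (rule rank_one_update_mult)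
      have sub: "subspace {x. B *v x = 0}" for B :: "real^'n^'n"
        by (rule linear_subspace_kernel) (simp add: matrix_vector_mul_linear)
      have "n \<bullet> x = 0 \<and> A *v x = 0" if x: "?A *v x = 0" for x
      proof -
        have "n \<bullet> x = 0"
        proof (rule ccontr)
          assume nx: "n \<bullet> x \<noteq> 0"
          \<comment> \<open>Dividing by \<open>n \<bullet> x\<close> would put \<open>a\<close> in
            the range of \<open>A\<close>.\<close>
          have "A *v x = - (n \<bullet> x) *\<^sub>R a" using x A_mult by (simp add: add_eq_0_iff2)
          then have "A *v ((- 1 / (n \<bullet> x)) *\<^sub>R x) = a"
            using nx by (simp only: matrix_vector_mult_scaleR) simp
          then show False using a by blast
        qed
        then show ?thesis using x A_mult by simp
      qed
      \<comment> \<open>The inclusion is strict because \<open>w\<close> is in the kernel of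
        \<open>A\<close> while \<open>n \<bullet> w \<noteq> 0\<close>.\<close>
      then have "{x. ?A *v x = 0} \<subset> {x. A *v x = 0}" using w F(2)[OF n] by blast
      then show "dim {x. ?A *v x = 0} < dim {x. A *v x = 0}"
        using dim_psubset[of "{x. ?A *v x = 0}" "{x. A *v x = 0}"] by (simp add: span_eq_iff[THEN iffD2, OF sub])
    qed
    then show ?thesis using nonsingular_inclusion_rank_one_step[OF F(1) _ slopes] by blast
  qed
qed

section \<open>Determinant and growth estimates\<close>

text \<open>The determinant is continuous at each of the finitely many invertible matrices; minima
  of the thresholds serve all of them.\<close>

lemma det_bounded_below_near_finite:
  fixes K :: "(real^'n^'n) set"
  assumes "finite K" "\<And>B. B \<in> K \<Longrightarrow> det B \<noteq> 0"
  shows "\<exists>c>0. \<exists>\<delta>>0. \<forall>B\<in>K. \<forall>E. norm E \<le> \<delta> \<longrightarrow> c \<le> \<bar>det (B + E)\<bar>"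
  using assms
proof (induction K rule: finite_induct)
  case empty
  show ?case by (auto intro: exI[of _ 1])
next
  case (insert B K)
  obtain c \<delta> where c: "c > 0" "\<delta> > 0" "\<And>B E. B \<in> K \<Longrightarrow> norm E \<le> \<delta> \<Longrightarrow> c \<le> \<bar>det (B + E)\<bar>"
    using insert by auto
  have "isCont (\<lambda>X::real^'n^'n. det X) B"
    unfolding det_def by (intro continuous_intros)
  moreover have "\<bar>det B\<bar> / 2 > 0" using insert.prems by simp
  ultimately obtain d where d: "d > 0"
    "\<And>X. dist X B < d \<Longrightarrow> dist (det X) (det B) < \<bar>det B\<bar> / 2"
    unfolding continuous_at_eps_delta by meson
  have "\<bar>det B\<bar> / 2 \<le> \<bar>det (B + E)\<bar>" if "norm E \<le> d / 2" for E
    using d(2)[of "B + E"] that \<open>d > 0\<close> unfolding dist_norm real_norm_def by simp argo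
  then show ?case
    using c d(1) \<open>\<bar>det B\<bar> / 2 > 0\<close>
    by (intro exI[of _ "min c (\<bar>det B\<bar> / 2)"] exI[of _ "min \<delta> (d / 2)"] conjI) (auto simp: min_le_iff_disj)
qed

lemma det_scaleR: "det (m *\<^sub>R A) = m ^ CARD('n) * det A" for A :: "real^'n^'n"
proof -
  have "m *\<^sub>R A = (\<chi> i. m *s A $ i)" by (simp add: vec_eq_iff)
  then show ?thesis by (simp add: det_rows_mul)
qed

text \<open>Since \<open>1 + s\<close> is at most \<open>2 * max 1 s\<close>, it suffices that the
  power of a maximum is bounded by the sum of the two powers.\<close>

lemma powr_affine_bound:
  fixes s C p :: real
  assumes "0 \<le> s" "0 \<le> C" "0 \<le> p"
  shows "(C * (1 + s)) powr p \<le> (2 * C) powr p * (1 + s powr p)"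
proof -
  have "(C * (1 + s)) powr p \<le> (2 * C * max 1 s) powr p"
  proof (rule powr_mono2)
    have "C * (1 + s) \<le> C * (2 * max 1 s)" using assms by (intro mult_left_mono) auto
    then show "C * (1 + s) \<le> 2 * C * max 1 s" by (simp add: mult_ac)
  qed (use assms in auto)
  also have "\<dots> = (2 * C) powr p * max 1 s powr p" using assms by (simp add: powr_mult)
  also have "\<dots> \<le> (2 * C) powr p * (1 + s powr p)"
    by (intro mult_left_mono) (auto simp: max_def)
  finally show ?thesis .
qed

section \<open>The test map on the unit cube and the growth bound\<close>

text \<open>This is the inclusion for the zero matrix on the open unit cube. The frontier is
  disjoint from the open cube, so vanishing off the cube gives the boundary condition.\<close>

lemma nonsingular_gradient_on_unit_cube:
  obtains \<phi> :: "real^'n \<Rightarrow> real^'n" and K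
  where "\<phi> \<in> W1inf0" "finite K" "\<And>B. B \<in> K \<Longrightarrow> det B \<noteq> 0"
    and "AE y in lebesgue. y \<in> box 0 1 \<longrightarrow> (\<exists>B\<in>K. (\<phi> has_derivative (*v) B) (at y))"
proof -
  obtain L K where K: "finite K" "\<forall>B\<in>K. det B \<noteq> 0"
    and *: "\<And>U::(real^'n) set. open U \<Longrightarrow> bounded U \<Longrightarrow> \<exists>\<phi>. L-lipschitz_on UNIV \<phi> \<and> (\<forall>y. y \<notin> U \<longrightarrow> \<phi> y = 0) \<and>
        negligible {y \<in> U. \<not> (\<exists>B\<in>K. (\<phi> has_derivative (\<lambda>h. (B - 0) *v h)) (at y))}"
    using nonsingular_inclusion[of 0] unfolding nonsingular_inclusion_def by blast
  obtain \<phi> where \<phi>: "L-lipschitz_on UNIV \<phi>" "\<forall>y. y \<notin> box 0 1 \<longrightarrow> \<phi> y = 0"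
    "negligible {y \<in> box 0 1. \<not> (\<exists>B\<in>K. (\<phi> has_derivative (*v) B) (at y))}"
    using *[OF open_box bounded_box, of 0 1] by auto
  show thesis
  proof
    have "\<phi> y = 0" if "y \<in> frontier (box 0 1)" for y
      using that \<phi>(2) by (auto simp: frontier_def interior_open[OF open_box])
    then show "\<phi> \<in> W1inf0"
      using lipschitz_on_subset[OF \<phi>(1)] by (auto simp: W1inf0_def)
    show "AE y in lebesgue. y \<in> box 0 1 \<longrightarrow> (\<exists>B\<in>K. (\<phi> has_derivative (*v) B) (at y))"
      using \<phi>(3) by (auto simp: negligible_iff_null_sets intro: AE_I')
  qed (use K in auto)
qed

lemma scaleR_W1inf0: "(\<lambda>y. m *\<^sub>R \<phi> y) \<in> W1inf0" if "\<phi> \<in> W1inf0"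
  using that lipschitz_on_cmult unfolding W1inf0_def by fastforce

lemma jacobian_eq:
  "jacobian \<phi> (at y) = B" if "(\<phi> has_derivative (*v) B) (at y)" for B :: "real^'n^'m"
  by (simp add: jacobian_def flip: frechet_derivative_at[OF that])

theorem theorem4p1:
  fixes f :: "real^'n \<Rightarrow> real^'n^'n \<Rightarrow> ennreal" and p :: real
  assumes "p \<ge> 1"
    and "normal_integrand f"
    and "\<exists>\<alpha> \<beta>. \<alpha> > 0 \<and> \<beta> > 0 \<and>
           (\<forall>x \<xi>. \<bar>det \<xi>\<bar> \<ge> \<alpha> \<longrightarrow> f x \<xi> \<le> ennreal (\<beta> * (1 + norm \<xi> powr p)))"
  shows "\<exists>c>0. \<forall>x \<xi>. Zf f x \<xi> \<le> ennreal (c * (1 + norm \<xi> powr p))"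
proof -
  obtain \<alpha> \<beta> where \<alpha>: "\<alpha> > 0" and \<beta>: "\<beta> > 0"
    and f: "\<And>x \<xi>. \<bar>det \<xi>\<bar> \<ge> \<alpha> \<Longrightarrow> f x \<xi> \<le> ennreal (\<beta> * (1 + norm \<xi> powr p))"
    using assms(3) by blast
  obtain \<phi> :: "real^'n \<Rightarrow> real^'n" and K where \<phi>: "\<phi> \<in> W1inf0"
    and K: "finite K" "\<And>B. B \<in> K \<Longrightarrow> det B \<noteq> 0"
    and ae: "AE y in lebesgue. y \<in> box 0 1 \<longrightarrow> (\<exists>B\<in>K. (\<phi> has_derivative (*v) B) (at y))"
    using nonsingular_gradient_on_unit_cube by blast
  obtain c \<delta> where c: "c > 0" and \<delta>: "\<delta> > 0"
    and det: "\<And>B E. B \<in> K \<Longrightarrow> norm E \<le> \<delta> \<Longrightarrow> c \<le> \<bar>det (B + E)\<bar>"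
    using det_bounded_below_near_finite[OF K] by blast
  obtain b where b: "b > 0" "\<And>B. B \<in> K \<Longrightarrow> norm B \<le> b"
    using finite_imp_bounded[OF K(1)] by (auto simp: bounded_pos)
  \<comment> \<open>The first term makes \<open>\<xi> / M \<xi>\<close> a perturbation of norm at
    most \<open>\<delta>\<close>; the constant makes \<open>M \<xi>\<close> at least 1 and at least
    \<open>\<alpha> / c\<close>, so that its N-th power times \<open>c\<close> reaches
    \<open>\<alpha>\<close>.\<close>
  define M where "M \<xi> = norm \<xi> / \<delta> + (1 + \<alpha> / c)" for \<xi> :: "real^'n^'n"
  \<comment> \<open>Chosen to dominate both coefficients of the affine bound in
    \<open>norm \<xi>\<close> obtained for
    \<open>norm (\<xi> + M \<xi> *\<^sub>R B)\<close>.\<close>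
  define C where "C = 1 + b / \<delta> + b * (1 + \<alpha> / c)"
  have C: "C > 0" using b(1) \<delta> \<alpha> c by (simp add: C_def add_pos_pos)
  have M: "M \<xi> \<ge> 1" "M \<xi> \<ge> \<alpha> / c" "norm \<xi> \<le> \<delta> * M \<xi>" for \<xi>
    using \<alpha> c \<delta> by (auto simp: M_def field_simps)
  have det_ge: "\<bar>det (\<xi> + M \<xi> *\<^sub>R B)\<bar> \<ge> \<alpha>" if "B \<in> K" for \<xi> B
  proof -
    have M0: "M \<xi> > 0" using M(1)[of \<xi>] by simp
    have "\<xi> + M \<xi> *\<^sub>R B = M \<xi> *\<^sub>R (B + (1 / M \<xi>) *\<^sub>R \<xi>)"
      using M0 by (simp add: scaleR_add_right)
    then have "\<bar>det (\<xi> + M \<xi> *\<^sub>R B)\<bar> = M \<xi> ^ CARD('n) * \<bar>det (B + (1 / M \<xi>) *\<^sub>R \<xi>)\<bar>"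
      using M0 by (simp add: det_scaleR abs_mult)
    moreover have "\<bar>det (B + (1 / M \<xi>) *\<^sub>R \<xi>)\<bar> \<ge> c"
      using M(3)[of \<xi>] M0 by (intro det that) (simp add: field_simps)
    \<comment> \<open>Here \<open>M \<xi> \<ge> 1\<close> and N is positive, so the N-th power is at
      least \<open>M \<xi>\<close>.\<close>
    moreover have "M \<xi> ^ CARD('n) \<ge> \<alpha> / c"
      using M(1,2)[of \<xi>] self_le_power[of "M \<xi>" "CARD('n)"] by simp
    ultimately have "\<bar>det (\<xi> + M \<xi> *\<^sub>R B)\<bar> \<ge> \<alpha> / c * c"
      using \<alpha> c M(1)[of \<xi>] by (simp only:) (intro mult_mono, auto)
    then show ?thesis using c by simp
  qed
  have norm_le: "norm (\<xi> + M \<xi> *\<^sub>R B) \<le> C * (1 + norm \<xi>)" if "B \<in> K" for \<xi> B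
  proof -
    have "norm (\<xi> + M \<xi> *\<^sub>R B) \<le> norm \<xi> + M \<xi> * norm B"
      using norm_triangle_ineq[of \<xi> "M \<xi> *\<^sub>R B"] M(1)[of \<xi>] by simp
    also have "\<dots> \<le> norm \<xi> + M \<xi> * b"
      using b(2)[OF that] M(1)[of \<xi>] by (intro add_left_mono mult_left_mono) auto
    also have "\<dots> = (1 + b / \<delta>) * norm \<xi> + b * (1 + \<alpha> / c)"
      by (simp add: M_def algebra_simps)
    also have "\<dots> \<le> C * norm \<xi> + C"
    proof (intro add_mono mult_right_mono)
      have "b / \<delta> \<ge> 0" "b * (1 + \<alpha> / c) \<ge> 0" using b(1) \<delta> \<alpha> c by auto
      then show "1 + b / \<delta> \<le> C" "b * (1 + \<alpha> / c) \<le> C" by (simp_all add: C_def)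
    qed simp
    finally show ?thesis by (simp add: algebra_simps)
  qed
  \<comment> \<open>The summand 1 absorbs the 1 in the growth condition, and
    \<open>(2 * C) powr p\<close> comes from \<open>powr_affine_bound\<close>.\<close>
  define c' where "c' = \<beta> * (1 + (2 * C) powr p)"
  have "Zf f x \<xi> \<le> ennreal (c' * (1 + norm \<xi> powr p))" for x \<xi>
  proof -
    let ?\<phi> = "\<lambda>y. M \<xi> *\<^sub>R \<phi> y"
    let ?r = "ennreal (c' * (1 + norm \<xi> powr p))"
    have le: "f x (\<xi> + M \<xi> *\<^sub>R B) \<le> ?r" if B: "B \<in> K" for B
    proof -
      have "norm (\<xi> + M \<xi> *\<^sub>R B) powr p \<le> (C * (1 + norm \<xi>)) powr p"
        using norm_le[OF B] assms(1) by (intro powr_mono2) auto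
      also have "\<dots> \<le> (2 * C) powr p * (1 + norm \<xi> powr p)"
        using C assms(1) by (intro powr_affine_bound) auto
      finally have "1 + norm (\<xi> + M \<xi> *\<^sub>R B) powr p \<le> (1 + (2 * C) powr p) * (1 + norm \<xi> powr p)"
        using powr_ge_zero[of "norm \<xi>" p] unfolding distrib_right by argo
      then have "\<beta> * (1 + norm (\<xi> + M \<xi> *\<^sub>R B) powr p) \<le> c' * (1 + norm \<xi> powr p)"
        using \<beta> unfolding c'_def mult.assoc by (intro mult_left_mono) auto
      then show ?thesis
        using f[OF det_ge[OF B]] ennreal_leI order_trans by blast
    qed
    have "Zf f x \<xi> \<le> (\<integral>\<^sup>+ y \<in> box 0 1. f x (\<xi> + jacobian ?\<phi> (at y)) \<partial>lebesgue)"
      unfolding Zf_def by (intro INF_lower scaleR_W1inf0 \<phi>)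
    \<comment> \<open>Almost everywhere the Jacobian of the scaled map is
      \<open>M \<xi> *\<^sub>R B\<close> with \<open>B \<in> K\<close>, so the integrand is at most
      the constant \<open>?r\<close>; the cube has measure 1.\<close>
    also have "\<dots> \<le> (\<integral>\<^sup>+ y. ?r * indicator (box 0 (1::real^'n)) y \<partial>lebesgue)"
    proof (rule nn_integral_mono_AE)
      show "AE y in lebesgue. f x (\<xi> + jacobian ?\<phi> (at y)) * indicator (box 0 1) y
              \<le> ?r * indicator (box 0 1) y"
        using ae
      proof eventually_elim
        case (elim y)
        show ?case
        proof (cases "y \<in> box 0 1")
          case True
          then obtain B where B: "B \<in> K" "(\<phi> has_derivative (*v) B) (at y)" using elim by blast
          have "(?\<phi> has_derivative (*v) (M \<xi> *\<^sub>R B)) (at y)"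
            using has_derivative_scaleR_right[OF B(2), of "M \<xi>"]
            by (simp add: scaleR_matrix_vector_assoc)
          then show ?thesis using le[OF B(1)] True by (simp add: jacobian_eq)
        qed simp
      qed
    qed
    also have "\<dots> = ?r * emeasure lebesgue (box 0 (1::real^'n))"
      by (rule nn_integral_cmult_indicator) simp
    also have "emeasure lebesgue (box 0 (1::real^'n)) = 1"
    proof -
      have "1 \<bullet> b = 1" if "b \<in> Basis" for b :: "real^'n"
        using that by (auto simp: Basis_vec_def inner_axis)
      then show ?thesis by (simp add: emeasure_lborel_box_eq)
    qed
    finally show ?thesis by simp
  qed
  moreover have "c' > 0" using \<beta> by (simp add: c'_def add_pos_nonneg)
  ultimately show ?thesis by blast
qed

end
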